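(* Let $Z$ be a universe and $E$ a set of parameters, and let $\Sigma$ be the set of all soft topologies on $Z$ (with parameter set $E$). Then $\Sigma$, ordered by inclusion of soft topologies, is a complete lattice.
   Context: A soft set over $Z$ is a pair $(Y,E)=\{(e,Y(e)):e\in E\}$ where $Y:E\to\mathcal{P}(Z)$ is a map into the power set of $Z$; the set of all soft sets over $Z$ is $\mathcal{P}(Z,E)$. Unions and intersections of soft sets are taken parameterwise: $(\bigcup_i Y_i)(e)=\bigcup_i Y_i(e)$ and $(\bigcap_i Y_i)(e)=\bigcap_i Y_i(e)$ for each $e\in E$. The null soft set $\widetilde{\Phi}$ has $\widetilde{\Phi}(e)=\emptyset$ for all $e$; the absolute soft set $\widetilde{Z}$ has $\widetilde{Z}(e)=Z$ for all $e$. A soft topology on $Z$ is a collection $\mathfrak{I}\subseteq\mathcal{P}(Z,E)$ containing $\widetilde{\Phi}$ and $\widetilde{Z}$, closed under intersections of two members and under arbitrary unions. A complete lattice is a partially ordered set in which every subset has a greatest lower bound and a least upper bound. *)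

theory Defs
  imports "HOL-Algebra.Complete_Lattice" "HOL-Library.FuncSet"
begin

text \<open>
  A soft set over \<open>Z\<close> with parameter set \<open>E\<close> is determined by its map \<open>Y : E \<rightarrow> Pow Z\<close>. Such a map is
  represented by the HOL function that agrees with it on \<open>E\<close> and is \<open>undefined\<close> outside \<open>E\<close>, so
  that equality of HOL functions is equality of soft sets.
\<close>

definition soft_sets :: "'a set \<Rightarrow> 'e set \<Rightarrow> ('e \<Rightarrow> 'a set) set" where
  "soft_sets Z E = (E \<rightarrow>\<^sub>E Pow Z)"

definition null_soft_set :: "'e set \<Rightarrow> 'e \<Rightarrow> 'a set" where
  "null_soft_set E = (\<lambda>e\<in>E. {})"

definition absolute_soft_set :: "'a set \<Rightarrow> 'e set \<Rightarrow> 'e \<Rightarrow> 'a set" where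
  "absolute_soft_set Z E = (\<lambda>e\<in>E. Z)"

definition soft_Union :: "'e set \<Rightarrow> ('e \<Rightarrow> 'a set) set \<Rightarrow> 'e \<Rightarrow> 'a set" where
  "soft_Union E \<F> = (\<lambda>e\<in>E. \<Union>Y\<in>\<F>. Y e)"

definition soft_inter :: "'e set \<Rightarrow> ('e \<Rightarrow> 'a set) \<Rightarrow> ('e \<Rightarrow> 'a set) \<Rightarrow> 'e \<Rightarrow> 'a set" where
  "soft_inter E Y W = (\<lambda>e\<in>E. Y e \<inter> W e)"

definition soft_topology :: "'a set \<Rightarrow> 'e set \<Rightarrow> ('e \<Rightarrow> 'a set) set \<Rightarrow> bool" where
  "soft_topology Z E \<T> \<longleftrightarrow>
     \<T> \<subseteq> soft_sets Z E \<and>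
     null_soft_set E \<in> \<T> \<and>
     absolute_soft_set Z E \<in> \<T> \<and>
     (\<forall>Y\<in>\<T>. \<forall>W\<in>\<T>. soft_inter E Y W \<in> \<T>) \<and>
     (\<forall>\<F>. \<F> \<subseteq> \<T> \<longrightarrow> soft_Union E \<F> \<in> \<T>)"

definition soft_topologies :: "'a set \<Rightarrow> 'e set \<Rightarrow> ('e \<Rightarrow> 'a set) set set" where
  "soft_topologies Z E = {\<T>. soft_topology Z E \<T>}"

definition soft_topology_order :: "'a set \<Rightarrow> 'e set \<Rightarrow> ('e \<Rightarrow> 'a set) set gorder" where
  "soft_topology_order Z E = \<lparr>carrier = soft_topologies Z E, eq = (=), le = (\<subseteq>)\<rparr>"

end

theory Submission
  imports Defs
begin

text \<open>
  The axioms of a soft topology are closure conditions on a family of soft sets, so they survive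
  arbitrary nonempty intersections (\<open>soft_topology_Inter\<close>), and the family of all soft
  sets is the largest soft topology (\<open>soft_topology_soft_sets\<close>). A poset with a greatest
  element in which every nonempty subset has an infimum is a complete lattice
  (\<open>complete_lattice_criterion1\<close>): the supremum of a family is the infimum of its upper
  bounds, a nonempty set since it contains the greatest element. Here this supremum is the
  intersection of all soft topologies that contain the union of the family; the union itself is in
  general not a soft topology.
\<close>

lemma soft_topology_soft_sets: "soft_topology Z E (soft_sets Z E)"
  by (auto simp: soft_topology_def soft_sets_def null_soft_set_def absolute_soft_set_def
      soft_inter_def soft_Union_def PiE_iff extensional_def subset_iff)

text \<open>
  Each axiom asks that a soft set built from members be a member again. Members of the intersection
  lie in every \<open>\<T>\<close>, hence so does the soft set built from them. Nonemptiness of \<open>A\<close> is what confines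
  the intersection to soft sets over \<open>Z\<close>.
\<close>

lemma soft_topology_Inter:
  assumes "A \<noteq> {}" and "\<And>\<T>. \<T> \<in> A \<Longrightarrow> soft_topology Z E \<T>"
  shows "soft_topology Z E (\<Inter>A)"
  unfolding soft_topology_def
proof (intro conjI ballI allI impI)
  show "\<Inter>A \<subseteq> soft_sets Z E"
    using assms unfolding soft_topology_def by blast
  show "null_soft_set E \<in> \<Inter>A" "absolute_soft_set Z E \<in> \<Inter>A"
    using assms(2) unfolding soft_topology_def by blast+
  show "soft_inter E Y W \<in> \<Inter>A" if "Y \<in> \<Inter>A" "W \<in> \<Inter>A" for Y W
    using assms(2) that unfolding soft_topology_def by blast
  show "soft_Union E \<F> \<in> \<Inter>A" if "\<F> \<subseteq> \<Inter>A" for \<F>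
    using assms(2) that unfolding soft_topology_def by (meson InterI Inter_lower order_trans)
qed

lemma partial_order_soft_topology_order: "partial_order (soft_topology_order Z E)"
  by standard (auto simp: soft_topology_order_def)

theorem theorem3p6:
  fixes Z :: "'a set" and E :: "'e set"
  shows "complete_lattice (soft_topology_order Z E)"
proof (rule partial_order.complete_lattice_criterion1[OF partial_order_soft_topology_order])
  let ?L = "soft_topology_order Z E"
  have "greatest ?L (soft_sets Z E) (carrier ?L)"
    using soft_topology_soft_sets[of Z E]
    by (auto simp: greatest_def soft_topology_order_def soft_topologies_def soft_topology_def)
  then show "\<exists>g. greatest ?L g (carrier ?L)" ..
next
  let ?L = "soft_topology_order Z E"
  fix A
  assume "A \<subseteq> carrier ?L" "A \<noteq> {}"
  then have "soft_topology Z E (\<Inter>A)"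
    by (intro soft_topology_Inter) (auto simp: soft_topology_order_def soft_topologies_def)
  then have "greatest ?L (\<Inter>A) (Lower ?L A)"
    using \<open>A \<subseteq> carrier ?L\<close>
    by (auto simp: greatest_def Lower_def soft_topology_order_def soft_topologies_def)
  then show "\<exists>i. greatest ?L i (Lower ?L A)" ..
qed

end
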